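(* $s'_{3,3}(m)=m+O(1)$ as $m\to\infty$.
   Context: All graphs are finite and simple. For an integer $t\ge1$, a $(3,t)'$-system is a pair $(H,\mathcal{F})$ where $H$ is a triangle-free graph and $\mathcal{F}$ is a family (without repeated elements) of subsets of $V(H)$, each of size exactly $t$, such that every $S\in\mathcal{F}$ is a maximal independent set of $H$ (independent, and every vertex outside $S$ has a neighbour in $S$). No intersection condition is imposed. For integers $m\ge0$, $s'_{3,t}(m)$ is the maximum of $|\mathcal{F}|$ over all $(3,t)'$-systems $(H,\mathcal{F})$ with $|V(H)|=m$. *)

theory Defs
  imports
    Complex_Main
    "HOL-Library.Landau_Symbols"
    "Graph_Theory.Pair_Digraph"
begin

text \<open>
  A finite simple graph is a \<open>pair_graph\<close>: finite vertex and arc sets, arcs between vertices,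
  no loops, and a symmetric arc relation. The edge \<open>uv\<close> is the pair of arcs
  \<open>(u, v)\<close>, \<open>(v, u)\<close>.
\<close>

definition triangle_free :: "'a pair_pre_digraph \<Rightarrow> bool" where
  "triangle_free H \<longleftrightarrow>
     \<not> (\<exists>u v w. (u, v) \<in> parcs H \<and> (v, w) \<in> parcs H \<and> (u, w) \<in> parcs H)"

definition independent_set :: "'a pair_pre_digraph \<Rightarrow> 'a set \<Rightarrow> bool" where
  "independent_set H S \<longleftrightarrow>
     S \<subseteq> pverts H \<and> (\<forall>u\<in>S. \<forall>v\<in>S. (u, v) \<notin> parcs H)"

definition maximal_independent_set :: "'a pair_pre_digraph \<Rightarrow> 'a set \<Rightarrow> bool" where
  "maximal_independent_set H S \<longleftrightarrow>
     independent_set H S \<and> (\<forall>v \<in> pverts H - S. \<exists>u\<in>S. (v, u) \<in> parcs H)"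

definition system3' :: "nat \<Rightarrow> 'a pair_pre_digraph \<Rightarrow> 'a set set \<Rightarrow> bool" where
  "system3' t H F \<longleftrightarrow>
     pair_graph H \<and> triangle_free H \<and>
     (\<forall>S\<in>F. S \<subseteq> pverts H \<and> card S = t \<and> maximal_independent_set H S)"

text \<open>
  The maximum is taken over graphs whose vertices are natural numbers. It exists, and it bounds
  the systems over every other vertex type as well: see \<open>s3'_attained\<close> and \<open>s3'_upper\<close>.
\<close>

definition s3' :: "nat \<Rightarrow> nat \<Rightarrow> nat" where
  "s3' t m = Max {card F | (H :: nat pair_pre_digraph) F. system3' t H F \<and> card (pverts H) = m}"

lemma system3'_family:
  assumes "system3' t H F"
  shows "F \<subseteq> Pow (pverts H)" "finite (pverts H)" "finite F" "card F \<le> 2 ^ card (pverts H)"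
proof -
  show sub: "F \<subseteq> Pow (pverts H)"
    using assms by (auto simp: system3'_def)
  have "pair_graph H"
    using assms by (simp add: system3'_def)
  then show fin: "finite (pverts H)"
    by (simp add: pair_graph_def pair_digraph_def pair_fin_digraph.pair_finite_verts)
  then show "finite F"
    using sub by (meson finite_Pow_iff finite_subset)
  show "card F \<le> 2 ^ card (pverts H)"
    using card_mono[OF _ sub] fin by (simp add: card_Pow)
qed

lemma finite_system3'_cards:
  "finite {card F | (H :: 'a pair_pre_digraph) F. system3' t H F \<and> card (pverts H) = m}"
  by (rule finite_subset[of _ "{..2 ^ m}"]) (auto dest: system3'_family(4))

lemma s3'_attained:
  obtains H :: "nat pair_pre_digraph" and F
  where "system3' t H F" "card (pverts H) = m" "card F = s3' t m"
proof -
  let ?A = "{card F | (H :: nat pair_pre_digraph) F. system3' t H F \<and> card (pverts H) = m}"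
  let ?H = "\<lparr>pverts = {..<m}, parcs = {}\<rparr> :: nat pair_pre_digraph"
  have "pair_graph ?H"
    by unfold_locales (auto simp: symmetric_def)
  then have "system3' t ?H {}" "card (pverts ?H) = m"
    by (auto simp: system3'_def triangle_free_def)
  then have "?A \<noteq> {}"
    by blast
  then have "s3' t m \<in> ?A"
    unfolding s3'_def by (intro Max_in finite_system3'_cards)
  then show thesis
    using that by force
qed

lemma s3'_upper:
  fixes H :: "'a pair_pre_digraph"
  assumes sys: "system3' t H F"
  shows "card F \<le> s3' t (card (pverts H))"
proof -
  let ?V = "pverts H"
  have pg: "pair_graph H" and tf: "triangle_free H"
    and F: "\<And>S. S \<in> F \<Longrightarrow> S \<subseteq> ?V \<and> card S = t \<and> maximal_independent_set H S"
    using sys by (auto simp: system3'_def)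
  have fin: "pair_fin_digraph H" and wf: "pair_wf_digraph H"
    and loopfree: "pair_loopfree_digraph H" and symd: "pair_sym_digraph H"
    using pg by (simp_all add: pair_graph_def pair_digraph_def pair_pseudo_graph_def
        pair_fin_digraph_def)
  have finite: "finite ?V" "finite (parcs H)"
    using fin by (rule pair_fin_digraph.pair_finite_verts pair_fin_digraph.pair_finite_arcs)+
  have inV: "u \<in> ?V" "v \<in> ?V" if "(u, v) \<in> parcs H" for u v
    using pair_wf_digraph.in_arcsD1[OF wf that] pair_wf_digraph.in_arcsD2[OF wf that] by simp_all
  have symH: "(v, u) \<in> parcs H" if "(u, v) \<in> parcs H" for u v
    using pair_sym_digraph.pair_sym_arcs[OF symd] that by (simp add: symmetric_def sym_def)
  have irrefl: "u \<noteq> v" if "(u, v) \<in> parcs H" for u v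
    using pair_loopfree_digraph.pair_no_loops[OF loopfree that] by simp
  obtain f :: "'a \<Rightarrow> nat" where f: "inj_on f ?V"
    using finite_imp_inj_to_nat_seg[OF finite(1)] by blast
  define K where "K = \<lparr>pverts = f ` ?V, parcs = map_prod f f ` parcs H\<rparr>"
  have arc: "(f u, f v) \<in> parcs K \<longleftrightarrow> (u, v) \<in> parcs H" if "u \<in> ?V" "v \<in> ?V" for u v
  proof
    assume "(f u, f v) \<in> parcs K"
    then obtain a b where ab: "(a, b) \<in> parcs H" "f u = f a" "f v = f b"
      by (auto simp: K_def)
    then have "a = u" "b = v"
      using that f inV[OF ab(1)] by (auto dest: inj_onD)
    with ab show "(u, v) \<in> parcs H" by simp
  qed (auto simp: K_def intro: rev_image_eqI)
  have arcE: "\<exists>u\<in>?V. \<exists>v\<in>?V. x = f u \<and> y = f v \<and> (u, v) \<in> parcs H"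
    if xy: "(x, y) \<in> parcs K" for x y
  proof -
    obtain u v where "(u, v) \<in> parcs H" "x = f u" "y = f v"
      using xy by (auto simp: K_def)
    with inV show ?thesis by blast
  qed
  have "pair_graph K"
  proof unfold_locales
    show "symmetric (with_proj K)"
      unfolding symmetric_def sym_def
      using arcE arc symH by (simp only: with_proj_simps) metis
    show "fst e \<noteq> snd e" if e: "e \<in> parcs K" for e
    proof -
      obtain u v where uv: "(u, v) \<in> parcs H" "e = (f u, f v)"
        using e by (auto simp: K_def)
      then show ?thesis
        using irrefl[OF uv(1)] inV[OF uv(1)] f by (auto dest: inj_onD)
    qed
  qed (use inV finite in \<open>auto simp: K_def\<close>)
  moreover have "triangle_free K"
    unfolding triangle_free_def
  proof safe
    fix x y z assume "(x, y) \<in> parcs K" "(y, z) \<in> parcs K" "(x, z) \<in> parcs K"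
    then obtain u v w where "u \<in> ?V" "v \<in> ?V" "w \<in> ?V" "x = f u" "y = f v" "z = f w"
      using arcE by metis
    then show False
      using tf arc \<open>(x, y) \<in> parcs K\<close> \<open>(y, z) \<in> parcs K\<close> \<open>(x, z) \<in> parcs K\<close>
      unfolding triangle_free_def by blast
  qed
  moreover have "f ` S \<subseteq> pverts K \<and> card (f ` S) = t \<and> maximal_independent_set K (f ` S)"
    if "S \<in> F" for S
  proof -
    have S: "S \<subseteq> ?V" "card S = t" "maximal_independent_set H S"
      using F that by auto
    have "card (f ` S) = t"
      using S f by (metis card_image inj_on_subset)
    moreover have "independent_set K (f ` S)"
      using S arc unfolding maximal_independent_set_def independent_set_def
      by (auto simp: K_def subset_iff)
    moreover have "\<exists>y\<in>f ` S. (x, y) \<in> parcs K" if x: "x \<in> pverts K - f ` S" for x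
    proof -
      obtain v where v: "v \<in> ?V - S" "x = f v"
        using x by (auto simp: K_def)
      then obtain u where "u \<in> S" "(v, u) \<in> parcs H"
        using S(3) unfolding maximal_independent_set_def by blast
      then show ?thesis
        using v S(1) arc by blast
    qed
    ultimately show ?thesis
      using S(1) by (auto simp: maximal_independent_set_def K_def)
  qed
  ultimately have "system3' t K ((`) f ` F)"
    by (auto simp: system3'_def)
  moreover have "card (pverts K) = card ?V"
    using f by (simp add: K_def card_image)
  moreover have "card ((`) f ` F) = card F"
  proof (rule card_image)
    show "inj_on ((`) f) F"
      using inj_on_image_Pow[OF f] system3'_family(1)[OF sys] by (rule inj_on_subset)
  qed
  ultimately have "card F \<in>
      {card F | (K :: nat pair_pre_digraph) F. system3' t K F \<and> card (pverts K) = card ?V}"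
    by (intro CollectI exI[of _ K] exI[of _ "(`) f ` F"]) simp
  then show ?thesis
    unfolding s3'_def by (intro Max_ge finite_system3'_cards)
qed

end

theory Submission
  imports Defs
begin

text \<open>
  Lower bound: remove a Hamiltonian path from a balanced complete bipartite graph; any three
  consecutive vertices of the path form a maximal independent set.

  Upper bound: for an independent set \<open>A\<close> with at least four elements, at most \<open>|V|\<close> members of the
  family \<open>F\<close> meet \<open>A\<close>. A member meeting \<open>A\<close> in two vertices is determined by its third vertex \<open>v\<close>,
  since \<open>v\<close> sees all the rest of \<open>A\<close>. The members meeting \<open>A\<close> exactly in \<open>x\<close> are charged to \<open>x\<close>
  and to vertices outside \<open>A\<close> whose trace on \<open>A\<close> identifies \<open>x\<close>.
  Taking for \<open>A\<close> the neighbourhood of a vertex \<open>v\<close> of degree at least four, a member that misses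
  \<open>A\<close> contains \<open>v\<close>, so \<open>|F| \<le> |V| + d\<close>, where \<open>d\<close> is the number of members containing \<open>v\<close>.

  It remains to find such a \<open>v\<close> with \<open>d < 8\<close>. If \<open>z\<close> lies in eight members \<open>{z, u\<^sub>i, w\<^sub>i}\<close>, then these
  form a crown: after relabelling, \<open>u\<^sub>i\<close> is adjacent to \<open>w\<^sub>j\<close> exactly for \<open>i \<noteq> j\<close>. If also \<open>u\<^sub>1\<close> and
  \<open>w\<^sub>1\<close> lie in eight members, then some neighbour of \<open>z\<close> sees all but at most two of the \<open>u\<^sub>i\<close>, whereas
  all but at most two of the \<open>u\<^sub>i\<close> see no neighbour of \<open>z\<close>. So if there is no suitable \<open>v\<close>, all degrees
  are at most three and \<open>|V| \<le> 12\<close>.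
\<close>

lemma card_ge_3E:
  assumes "3 \<le> card I"
  obtains i j k where "i \<in> I" "j \<in> I" "k \<in> I" "i \<noteq> j" "i \<noteq> k" "j \<noteq> k"
proof -
  obtain T where "T \<subseteq> I" "card T = 3"
    using assms by (rule obtain_subset_with_card_n)
  with that show thesis
    unfolding card_3_iff by blast
qed

section \<open>Domination by members of the family and their third vertices\<close>

locale mis3 =
  fixes H :: "'a pair_pre_digraph" and F :: "'a set set"
  assumes sys: "system3' 3 H F"
begin

abbreviation V where "V \<equiv> pverts H"

abbreviation adj where "adj u v \<equiv> (u, v) \<in> parcs H"

definition nb where "nb v = {u. adj v u}"

lemma adj_sym: "adj u v \<Longrightarrow> adj v u"
  and adj_V: "adj u v \<Longrightarrow> u \<in> V \<and> v \<in> V"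
  and finite_V: "finite V"
proof -
  have pg: "pair_graph H"
    using sys by (simp add: system3'_def)
  then have fin: "pair_fin_digraph H" and wf: "pair_wf_digraph H"
    and symd: "pair_sym_digraph H"
    by (simp_all add: pair_graph_def pair_digraph_def pair_pseudo_graph_def pair_fin_digraph_def)
  show "adj u v \<Longrightarrow> adj v u"
    using pair_sym_digraph.pair_sym_arcs[OF symd] by (simp add: symmetric_def sym_def)
  show "adj u v \<Longrightarrow> u \<in> V \<and> v \<in> V"
    using pair_wf_digraph.in_arcsD1[OF wf] pair_wf_digraph.in_arcsD2[OF wf] by simp
  show "finite V"
    using system3'_family(2)[OF sys] .
qed

lemma finite_F: "finite F"
  using system3'_family(3)[OF sys] .

lemma no_triangle: "adj a b \<Longrightarrow> adj a c \<Longrightarrow> \<not> adj b c"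
  using sys unfolding system3'_def triangle_free_def by blast

lemma finite_nb: "finite (nb v)"
  by (rule finite_subset[OF _ finite_V]) (auto simp: nb_def dest: adj_V)

lemma F_memE:
  assumes "S \<in> F" "x \<in> S"
  obtains y z where "S = {x, y, z}"
proof -
  have "card S = 3"
    using sys assms by (auto simp: system3'_def)
  then obtain a b c where "S = {a, b, c}"
    by (auto simp: card_3_iff)
  with assms(2) have "S = {x, b, c} \<or> S = {x, a, c} \<or> S = {x, a, b}"
    by auto
  with that show thesis by blast
qed

lemma tripleD:
  assumes "{x, y, z} \<in> F"
  shows "x \<in> V" "y \<in> V" "z \<in> V" "x \<noteq> y" "x \<noteq> z" "y \<noteq> z"
    "\<not> adj x y" "\<not> adj y x" "\<not> adj x z" "\<not> adj z x" "\<not> adj y z" "\<not> adj z y"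
proof -
  have "{x, y, z} \<subseteq> V" "card {x, y, z} = 3" "independent_set H {x, y, z}"
    using sys assms by (auto simp: system3'_def maximal_independent_set_def)
  then show "x \<in> V" "y \<in> V" "z \<in> V" "x \<noteq> y" "x \<noteq> z" "y \<noteq> z"
    "\<not> adj x y" "\<not> adj y x" "\<not> adj x z" "\<not> adj z x" "\<not> adj y z" "\<not> adj z y"
    by (simp_all add: independent_set_def card_insert_if split: if_splits)
qed

lemma triple_dom:
  assumes "{x, y, z} \<in> F" "v \<in> V" "v \<noteq> x" "v \<noteq> y" "v \<noteq> z"
  shows "adj v x \<or> adj v y \<or> adj v z"
proof -
  have "maximal_independent_set H {x, y, z}"
    using sys assms(1) by (simp add: system3'_def)
  with assms(2-) show ?thesis
    by (simp add: maximal_independent_set_def)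
qed

text \<open>\<open>{x, y, t'}\<close> must dominate \<open>t\<close>, and \<open>t\<close> sees
  neither \<open>x\<close> nor \<open>y\<close>.\<close>

lemma third_adj:
  assumes "{x, y, t} \<in> F" "{x, y, t'} \<in> F" "t \<noteq> t'"
  shows "adj t t'"
  using triple_dom[OF assms(2), of t] tripleD[OF assms(1)] assms(3) by simp

lemma F_mem2E:
  assumes "S \<in> F" "x \<in> S" "y \<in> S" "x \<noteq> y"
  obtains t where "S = {x, y, t}"
proof -
  obtain a b where "S = {x, a, b}"
    by (rule F_memE[OF assms(1,2)])
  with assms(3,4) have "S = {x, y, b} \<or> S = {x, y, a}" by auto
  with that show thesis by blast
qed

text \<open>The third vertices of three members through \<open>x\<close> and \<open>y\<close> would
  be pairwise adjacent, hence a triangle.\<close>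

lemma card_codegree_le_2:
  assumes "x \<noteq> y"
  shows "card {S \<in> F. x \<in> S \<and> y \<in> S} \<le> 2"
proof (rule ccontr)
  assume "\<not> ?thesis"
  then have "3 \<le> card {S \<in> F. x \<in> S \<and> y \<in> S}" by simp
  then obtain S1 S2 S3 where sub: "S1 \<in> {S \<in> F. x \<in> S \<and> y \<in> S}"
      "S2 \<in> {S \<in> F. x \<in> S \<and> y \<in> S}" "S3 \<in> {S \<in> F. x \<in> S \<and> y \<in> S}"
    and ne: "S1 \<noteq> S2" "S1 \<noteq> S3" "S2 \<noteq> S3"
    by (rule card_ge_3E)
  from sub have S: "S1 \<in> F" "S2 \<in> F" "S3 \<in> F" "x \<in> S1" "x \<in> S2" "x \<in> S3"
      "y \<in> S1" "y \<in> S2" "y \<in> S3"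
    by simp_all
  obtain t1 where t1: "S1 = {x, y, t1}" using F_mem2E[OF S(1,4,7) assms] .
  obtain t2 where t2: "S2 = {x, y, t2}" using F_mem2E[OF S(2,5,8) assms] .
  obtain t3 where t3: "S3 = {x, y, t3}" using F_mem2E[OF S(3,6,9) assms] .
  have "adj t1 t2" "adj t1 t3" "adj t2 t3"
    using S(1-3) ne third_adj[of x y] unfolding t1 t2 t3 by blast+
  then show False
    using no_triangle by blast
qed

lemma nb_disjoint: "adj u v \<Longrightarrow> nb u \<inter> nb v = {}"
  using no_triangle adj_sym unfolding nb_def by blast

lemma nb_indep: "a \<in> nb v \<Longrightarrow> b \<in> nb v \<Longrightarrow> \<not> adj a b"
  using no_triangle unfolding nb_def by blast

lemma adj_comm: "adj u v \<longleftrightarrow> adj v u"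
  using adj_sym by blast

subsection \<open>Members meeting an independent set\<close>

context
  fixes A
  assumes A_V: "A \<subseteq> V"
    and A_indep: "\<And>a b. a \<in> A \<Longrightarrow> b \<in> A \<Longrightarrow> \<not> adj a b"
    and A_card: "4 \<le> card A"
begin

text \<open>For \<open>x\<close> in \<open>A\<close> the trace \<open>A - {x}\<close> determines
  \<open>x\<close>, so members of \<open>star x\<close> can be charged to these vertices without
  conflict between different such \<open>x\<close>.\<close>

definition full where "full x = {v \<in> V - A. A \<inter> nb v = A - {x}}"

definition star where "star x = {S \<in> F. S \<inter> A = {x}}"

text \<open>
  If \<open>full x\<close> is empty and \<open>star x\<close> has at least two members, then all of them induce the same
  partition of \<open>A - {x}\<close> into the traces of their two vertices outside \<open>A\<close>.
\<close>

definition split where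
  "split x P Q \<longleftrightarrow> x \<in> A \<and> P \<noteq> {} \<and> Q \<noteq> {} \<and> P \<inter> Q = {} \<and> P \<union> Q = A - {x} \<and> 2 \<le> card (star x) \<and>
     (\<forall>S\<in>star x. \<exists>y z. S = {x, y, z} \<and> y \<notin> A \<and> z \<notin> A \<and> A \<inter> nb y = P \<and> A \<inter> nb z = Q)"

lemma finite_A: "finite A"
  using A_V finite_V by (rule finite_subset)

lemma finite_full: "finite (full x)"
  using finite_V by (simp add: full_def)

lemma finite_star: "finite (star x)"
  using finite_F by (simp add: star_def)

lemma ex_other: obtains a where "a \<in> A" "a \<noteq> x"
proof -
  have "\<not> A \<subseteq> {x}"
    using A_card card_mono[of "{x}" A] by auto
  with that show thesis by blast
qed

lemma star_memE:
  assumes "S \<in> star x" "s \<in> S" "s \<noteq> x"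
  obtains t where "S = {x, s, t}" "{x, s, t} \<in> F" "x \<in> A" "s \<notin> A" "t \<notin> A" "t \<noteq> x"
proof -
  have S: "S \<in> F" "S \<inter> A = {x}" "x \<in> S" "x \<in> A"
    using assms by (auto simp: star_def)
  obtain t where t: "S = {x, s, t}"
    using F_mem2E[OF S(1,3) assms(2)] assms(3) by metis
  then have "{x, s, t} \<in> F" using S(1) by simp
  then have "t \<noteq> x" using tripleD(5) by metis
  then show thesis
    using that[of t] t S assms(3) by blast
qed

lemma starE:
  assumes "S \<in> star x"
  obtains s t where "S = {x, s, t}" "{x, s, t} \<in> F" "x \<in> A" "s \<notin> A" "t \<notin> A"
proof -
  have S: "S \<in> F" "x \<in> S"
    using assms by (auto simp: star_def)
  obtain s t where t: "S = {x, s, t}"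
    using F_memE[OF S] .
  then have "{x, s, t} \<in> F" using S(1) by simp
  then have "s \<noteq> x"
    using tripleD(4) by metis
  then show thesis
    using star_memE[OF assms, of s] t that by (metis insertI1 insert_commute)
qed

text \<open>\<open>A\<close> is independent, so \<open>x\<close> dominates nothing else in
  \<open>A\<close>; this is left to \<open>s\<close> and \<open>t\<close>.\<close>

lemma star_cover:
  assumes "{x, s, t} \<in> F" "x \<in> A" "s \<notin> A" "t \<notin> A"
  shows "A - {x} \<subseteq> nb s \<union> nb t" "x \<notin> nb s" "x \<notin> nb t"
proof -
  show "x \<notin> nb s" "x \<notin> nb t"
    using tripleD[OF assms(1)] by (auto simp: nb_def)
  show "A - {x} \<subseteq> nb s \<union> nb t"
  proof
    fix a assume a: "a \<in> A - {x}"
    then have "adj a s \<or> adj a t"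
      using triple_dom[OF assms(1), of a] assms A_V A_indep by blast
    then show "a \<in> nb s \<union> nb t"
      by (simp add: nb_def adj_comm[of _ a])
  qed
qed

section \<open>Stars with full vertices\<close>

lemma full_nonadj:
  assumes "f \<in> full x" "f' \<in> full x"
  shows "\<not> adj f f'"
proof -
  obtain a where "a \<in> A" "a \<noteq> x" by (rule ex_other)
  then have "a \<in> nb f" "a \<in> nb f'"
    using assms by (auto simp: full_def)
  then show ?thesis
    using nb_disjoint by blast
qed

text \<open>If \<open>y\<close> is not in \<open>S\<close>, it sees \<open>s\<close> or
  \<open>t\<close>. That vertex has no common neighbour with \<open>y\<close>, so it sees nothing of
  \<open>A - {x}\<close>, and the other one must see all of it.\<close>

lemma star_meets_full:
  assumes "y \<in> full x" "S \<in> star x"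
  shows "\<exists>f\<in>full x. f \<in> S"
proof -
  obtain s t where S: "S = {x, s, t}" "{x, s, t} \<in> F" "x \<in> A" "s \<notin> A" "t \<notin> A"
    using starE[OF assms(2)] .
  note cov = star_cover[OF S(2-5)]
  have y: "y \<in> V" "y \<notin> A" "A - {x} \<subseteq> nb y" "x \<notin> nb y"
    using assms(1) S(3) unfolding full_def by blast+
  show ?thesis
  proof (cases "y \<in> S")
    case False
    then have "adj y s \<or> adj y t"
      using triple_dom[OF S(2), of y] y S(1) adj_comm[of x y] by (auto simp: nb_def)
    then show ?thesis
    proof
      assume "adj y s"
      then have "A - {x} \<subseteq> nb t"
        using nb_disjoint cov(1) y(3) by blast
      then have "t \<in> full x"
        using cov(3) S(5) tripleD(3)[OF S(2)] by (auto simp: full_def)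
      with S(1) show ?thesis by blast
    next
      assume "adj y t"
      then have "A - {x} \<subseteq> nb s"
        using nb_disjoint cov(1) y(3) by blast
      then have "s \<in> full x"
        using cov(2) S(4) tripleD(2)[OF S(2)] by (auto simp: full_def)
      with S(1) show ?thesis by blast
    qed
  qed (use assms in blast)
qed

text \<open>If there is only one full vertex, all members of the star contain it and
  \<open>x\<close>, and the codegree bound gives two. Otherwise each member is charged to a full
  vertex in it; this is injective once the single possible member \<open>insert x (full x)\<close>
  is set aside, which accounts for the \<open>Suc\<close>.\<close>

lemma card_star_le_full:
  assumes "x \<in> A" "full x \<noteq> {}"
  shows "card (star x) \<le> Suc (card (full x))"
proof (cases "\<exists>y. full x = {y}")
  case True
  then obtain y where y: "full x = {y}" by blast
  then have "star x \<subseteq> {S \<in> F. x \<in> S \<and> y \<in> S}"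
    using star_meets_full[of y x] by (auto simp: star_def)
  moreover have "x \<noteq> y"
    using y assms(1) by (auto simp: full_def)
  ultimately have "card (star x) \<le> 2"
    using card_codegree_le_2[of x y] card_mono[of "{S \<in> F. x \<in> S \<and> y \<in> S}" "star x"] finite_F
    by fastforce
  then show ?thesis using y by simp
next
  case False
  define g where "g S = (SOME f. f \<in> full x \<and> f \<in> S)" for S
  have g: "g S \<in> full x" "g S \<in> S" "g S \<noteq> x" if "S \<in> star x" for S
  proof -
    show 1: "g S \<in> full x" "g S \<in> S"
      using star_meets_full[OF _ that] assms(2) someI_ex[of "\<lambda>f. f \<in> full x \<and> f \<in> S"]
      unfolding g_def by blast+
    then show "g S \<noteq> x"
      using assms(1) by (auto simp: full_def)
  qed
  \<comment> \<open>Full vertices see neither each other nor \<open>x\<close>, so a further full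
    vertex \<open>h\<close> would not be dominated.\<close>
  have full_third: "S = insert x (full x)"
    if S: "S = {x, f, t}" "{x, f, t} \<in> F" "f \<in> full x" "t \<in> full x" for S f t
  proof -
    have "h = f \<or> h = t" if h: "h \<in> full x" for h
    proof (rule ccontr)
      assume "\<not> ?thesis"
      moreover have "h \<in> V" "h \<noteq> x" "\<not> adj h x"
        using h assms(1) by (auto simp: full_def nb_def)
      ultimately show False
        using triple_dom[OF S(2), of h] full_nonadj h S(3,4) by blast
    qed
    then show ?thesis
      using S by blast
  qed
  have "inj_on g (star x - {insert x (full x)})"
  proof (rule inj_onI, rule ccontr)
    fix S S'
    assume S: "S \<in> star x - {insert x (full x)}" and S': "S' \<in> star x - {insert x (full x)}"
      and eq: "g S = g S'" and ne: "S \<noteq> S'"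
    define f where "f = g S"
    have f: "f \<in> full x" "f \<in> S" "f \<in> S'" "f \<noteq> x"
      using g[of S] g[of S'] S S' eq unfolding f_def by simp_all
    obtain t where t: "S = {x, f, t}" "{x, f, t} \<in> F"
      using star_memE[OF DiffD1[OF S] f(2,4)] .
    obtain t' where t': "S' = {x, f, t'}" "{x, f, t'} \<in> F"
      using star_memE[OF DiffD1[OF S'] f(3,4)] .
    have nonfull: "t \<notin> full x" "t' \<notin> full x"
      using full_third[OF t(1,2) f(1)] full_third[OF t'(1,2) f(1)] S S' by auto
    have "adj t t'"
      using third_adj[OF t(2) t'(2)] ne t(1) t'(1) by blast
    \<comment> \<open>A second full vertex \<open>h\<close> sees neither \<open>x\<close> nor
      \<open>f\<close>, so it must see both \<open>t\<close> and \<open>t'\<close>, which closes a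
      triangle.\<close>
    obtain h where h: "h \<in> full x" "h \<noteq> f"
      using False f(1) by blast
    then have "h \<in> V" "h \<noteq> x" "\<not> adj h x"
      using assms(1) by (auto simp: full_def nb_def)
    then have "adj h t" "adj h t'"
      using triple_dom[OF t(2), of h] triple_dom[OF t'(2), of h] h nonfull full_nonadj f(1)
      by blast+
    with \<open>adj t t'\<close> no_triangle show False by blast
  qed
  then have "card (star x - {insert x (full x)}) \<le> card (full x)"
    by (rule card_inj_on_le) (use g finite_full in auto)
  then show ?thesis
    using card_Diff_singleton_if[of "star x" "insert x (full x)"] by (auto split: if_splits)
qed

section \<open>Stars without full vertices and their splits\<close>

text \<open>The third vertices \<open>t\<close> and \<open>t'\<close> are adjacent, so each vertex
  of \<open>A - {x}\<close> is missed by one of them and therefore seen by \<open>y\<close>, which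
  would be full.\<close>

lemma star_disjoint:
  assumes "full x = {}" "S \<in> star x" "S' \<in> star x" "S \<noteq> S'" "y \<in> S" "y \<in> S'"
  shows "y = x"
proof (rule ccontr)
  assume ne: "y \<noteq> x"
  obtain t where t: "S = {x, y, t}" "{x, y, t} \<in> F" "x \<in> A" "y \<notin> A" "t \<notin> A"
    using star_memE[OF assms(2,5) ne] .
  obtain t' where t': "S' = {x, y, t'}" "{x, y, t'} \<in> F" "t' \<notin> A"
    using star_memE[OF assms(3,6) ne] .
  have "adj t t'"
    using third_adj[OF t(2) t'(2)] assms(4) t(1) t'(1) by blast
  then have "A - {x} \<subseteq> nb y"
    using star_cover(1)[OF t(2-5)] star_cover(1)[OF t'(2) t(3,4) t'(3)] nb_disjoint by blast
  then have "y \<in> full x"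
    using star_cover(2)[OF t(2-5)] t(4) tripleD(2)[OF t(2)] by (auto simp: full_def)
  with assms(1) show False by blast
qed

text \<open>A vertex of \<open>A\<close> seen by \<open>y1\<close> is missed by \<open>y2\<close>,
  hence seen by \<open>z2\<close>, hence missed by \<open>z1\<close>; the other inclusions are
  symmetric.\<close>

lemma star_pair:
  assumes "{x, y1, z1} \<in> F" "{x, y2, z2} \<in> F" "x \<in> A" "y1 \<notin> A" "z1 \<notin> A" "y2 \<notin> A" "z2 \<notin> A"
    and "adj y1 y2" "adj z1 z2"
  shows "A \<inter> nb y1 = A \<inter> nb z2" "A \<inter> nb z1 = A \<inter> nb y2"
    "nb y1 \<inter> nb z1 \<inter> A = {}" "(A \<inter> nb y1) \<union> (A \<inter> nb z1) = A - {x}"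
proof -
  note c1 = star_cover[OF assms(1,3,4,5)] and c2 = star_cover[OF assms(2,3,6,7)]
  note d1 = nb_disjoint[OF assms(8)] and d2 = nb_disjoint[OF assms(9)]
  show eq1: "A \<inter> nb y1 = A \<inter> nb z2"
    using c1 c2 d1 d2 by blast
  show "A \<inter> nb z1 = A \<inter> nb y2"
    using c1 c2 d1 d2 by blast
  show "nb y1 \<inter> nb z1 \<inter> A = {}"
    using eq1 d2 by blast
  show "(A \<inter> nb y1) \<union> (A \<inter> nb z1) = A - {x}"
    using c1 by blast
qed

text \<open>The two members share only \<open>x\<close> and dominate each other, so each of their
  four remaining vertices has a neighbour in the other pair. Such a bipartite graph on two plus two
  vertices has a perfect matching.\<close>

lemma star_pair_cases:
  assumes fl: "full x = {}" and S: "S \<in> star x" "S' \<in> star x" "S \<noteq> S'" "S = {x, y1, z1}"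
  obtains y2 z2 where "S' = {x, y2, z2}" "y1 \<notin> A" "z1 \<notin> A" "y2 \<notin> A" "z2 \<notin> A" "adj y1 y2" "adj z1 z2"
proof -
  have F1: "{x, y1, z1} \<in> F" and xA: "x \<in> A" and i1: "{x, y1, z1} \<inter> A = {x}"
    using S by (auto simp: star_def)
  note t1 = tripleD[OF F1]
  have n1: "y1 \<notin> A" "z1 \<notin> A"
    using i1 t1(4,5) by auto
  obtain y z where S': "S' = {x, y, z}" "{x, y, z} \<in> F" "y \<notin> A" "z \<notin> A"
    using starE[OF S(2)] .
  note t2 = tripleD[OF S'(2)]
  have ne: "y1 \<noteq> y" "y1 \<noteq> z" "z1 \<noteq> y" "z1 \<noteq> z"
    using star_disjoint[OF fl S(1-3), of y1] star_disjoint[OF fl S(1-3), of z1] t1(4,5)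
    unfolding S(4) S'(1) by blast+
  have a: "adj y1 y \<or> adj y1 z" "adj z1 y \<or> adj z1 z"
    using triple_dom[OF S'(2), of y1] triple_dom[OF S'(2), of z1] t1 ne by metis+
  have b: "adj y1 y \<or> adj z1 y" "adj y1 z \<or> adj z1 z"
    using triple_dom[OF F1, of y] triple_dom[OF F1, of z] t2 ne adj_comm by metis+
  have "S' = {x, z, y}" using S'(1) by auto
  then show thesis
    using a b that[OF S'(1) n1 S'(3,4)] that[of z y] n1 S'(3,4) by blast
qed

lemma split_sym: "split x P Q \<Longrightarrow> split x Q P"
proof -
  assume *: "split x P Q"
  have "\<exists>z y. S = {x, z, y} \<and> z \<notin> A \<and> y \<notin> A \<and> A \<inter> nb z = Q \<and> A \<inter> nb y = P"
    if "S \<in> star x" for S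
  proof -
    obtain y z where y: "S = {x, y, z}" "y \<notin> A" "z \<notin> A" "A \<inter> nb y = P" "A \<inter> nb z = Q"
      using * \<open>S \<in> star x\<close> unfolding split_def by metis
    moreover have "S = {x, z, y}" using y(1) by auto
    ultimately show ?thesis by metis
  qed
  moreover have "Q \<inter> P = {}" "Q \<union> P = A - {x}"
    using * unfolding split_def by (simp_all add: Int_commute Un_commute)
  ultimately show "split x Q P"
    using * unfolding split_def by metis
qed

text \<open>The matching between a fixed member \<open>S1\<close> and any other member forces the
  traces of the latter to be those of \<open>S1\<close>, swapped. If one trace were empty, the
  vertex with the other trace would be full.\<close>

lemma ex_split:
  assumes "x \<in> A" and fl: "full x = {}" and two: "2 \<le> card (star x)"
  shows "\<exists>P Q. split x P Q"
proof -
  obtain T where T: "T \<subseteq> star x" "card T = 2"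
    using two by (rule obtain_subset_with_card_n)
  then obtain S1 S2 where S: "S1 \<in> star x" "S2 \<in> star x" "S1 \<noteq> S2"
    unfolding card_2_iff by blast
  obtain y1 z1 where S1: "S1 = {x, y1, z1}" "{x, y1, z1} \<in> F" "y1 \<notin> A" "z1 \<notin> A"
    using starE[OF S(1)] .
  define P where "P = A \<inter> nb y1"
  define Q where "Q = A \<inter> nb z1"
  have other: "P \<inter> Q = {} \<and> P \<union> Q = A - {x} \<and>
      (\<exists>y z. S = {x, y, z} \<and> y \<notin> A \<and> z \<notin> A \<and> A \<inter> nb y = P \<and> A \<inter> nb z = Q)"
    if Sx: "S \<in> star x" "S1 \<noteq> S" for S
  proof -
    obtain y2 z2 where y2: "S = {x, y2, z2}" "y2 \<notin> A" "z2 \<notin> A" "adj y1 y2" "adj z1 z2"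
      using star_pair_cases[OF fl S(1) Sx S1(1)] .
    have "{x, y2, z2} \<in> F"
      using Sx(1) y2(1) by (simp add: star_def)
    note sp = star_pair[OF S1(2) this assms(1) S1(3,4) y2(2-5)]
    have "S = {x, z2, y2}" using y2(1) by auto
    then have "\<exists>y z. S = {x, y, z} \<and> y \<notin> A \<and> z \<notin> A \<and> A \<inter> nb y = P \<and> A \<inter> nb z = Q"
      using sp(1,2) y2(2,3) unfolding P_def Q_def by metis
    moreover have "P \<inter> Q = {}" "P \<union> Q = A - {x}"
      using sp(3,4) unfolding P_def Q_def by blast+
    ultimately show ?thesis by blast
  qed
  have "\<forall>S\<in>star x. \<exists>y z. S = {x, y, z} \<and> y \<notin> A \<and> z \<notin> A \<and> A \<inter> nb y = P \<and> A \<inter> nb z = Q"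
    using other S1(1,3,4) P_def Q_def by metis
  moreover have PQ: "P \<inter> Q = {}" "P \<union> Q = A - {x}"
    using other S by blast+
  moreover have "P \<noteq> {}"
  proof
    assume "P = {}"
    then have "z1 \<in> full x"
      using PQ S1(4) tripleD(3)[OF S1(2)] unfolding Q_def full_def by blast
    with fl show False by blast
  qed
  moreover have "Q \<noteq> {}"
  proof
    assume "Q = {}"
    then have "y1 \<in> full x"
      using PQ S1(3) tripleD(2)[OF S1(2)] unfolding P_def full_def by blast
    with fl show False by blast
  qed
  ultimately have "split x P Q"
    unfolding split_def using assms(1) two by blast
  then show ?thesis by blast
qed

lemma splitD:
  assumes "split x P Q"
  shows "x \<in> A" "P \<noteq> {}" "Q \<noteq> {}" "P \<inter> Q = {}" "P \<union> Q = A - {x}"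
  using assms unfolding split_def by simp_all

lemma split_iff:
  assumes "split x P Q"
  shows "v \<in> P \<longleftrightarrow> v \<in> A \<and> v \<noteq> x \<and> v \<notin> Q"
  using splitD(4,5)[OF assms] by blast

lemma split_memE:
  assumes "split x P Q" "S \<in> star x"
  obtains y z where "S = {x, y, z}" "{x, y, z} \<in> F" "y \<notin> A" "z \<notin> A" "A \<inter> nb y = P" "A \<inter> nb z = Q"
proof -
  obtain y z where y: "S = {x, y, z}" "y \<notin> A" "z \<notin> A" "A \<inter> nb y = P" "A \<inter> nb z = Q"
    using assms unfolding split_def by metis
  moreover have "{x, y, z} \<in> F"
    using assms(2) y(1) by (simp add: star_def)
  ultimately show thesis using that by metis
qed

lemma split_ex:
  assumes "split x P Q"
  obtains y z where "{x, y, z} \<in> F" "y \<notin> A" "z \<notin> A" "A \<inter> nb y = P" "A \<inter> nb z = Q"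
proof -
  have "star x \<noteq> {}"
    using assms by (auto simp: split_def)
  then obtain S where "S \<in> star x" by blast
  from split_memE[OF assms this] that show thesis by metis
qed

text \<open>
  View \<open>split x P Q\<close> as an edge labelled \<open>x\<close> between the subsets \<open>P\<close> and \<open>Q\<close> of \<open>A\<close>. There is no
  path with three edges, so every edge has an endpoint of degree one, and this endpoint
  identifies \<open>x\<close>.
\<close>

lemma split_no_path:
  assumes 1: "split x1 P1 P2" and 2: "split x2 P2 P3" and 3: "split x3 P3 P4"
    and ne: "x1 \<noteq> x2" "x2 \<noteq> x3"
  shows False
proof -
  note d1 = splitD[OF 1] and d2 = splitD[OF 2] and d3 = splitD[OF 3]
  note i = split_iff[OF 1] split_iff[OF 2] split_iff[OF 3] split_iff[OF split_sym[OF 1]]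
    split_iff[OF split_sym[OF 2]] split_iff[OF split_sym[OF 3]]
  have x: "x1 \<in> P3" "x3 \<in> P2" "x2 \<in> P1" "x2 \<in> P4" "x1 \<notin> P4" "x3 \<notin> P1"
    using i d1(1) d2(1) d3(1) ne by metis+
  obtain a b where ab: "{x1, a, b} \<in> F" "a \<notin> A" "b \<notin> A" "A \<inter> nb a = P1" "A \<inter> nb b = P2"
    using split_ex[OF 1] .
  obtain c d where cd: "{x3, c, d} \<in> F" "c \<notin> A" "d \<notin> A" "A \<inter> nb c = P3" "A \<inter> nb d = P4"
    using split_ex[OF 3] .
  have nadj: "\<not> adj d x1" "\<not> adj a x3"
    using x(5,6) ab(4) cd(5) d1(1) d3(1) by (auto simp: nb_def)
  have nda: "\<not> adj d a" "\<not> adj a d"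
    using nb_disjoint[of d a] nb_disjoint[of a d] x(3,4) ab(4) cd(5) by blast+
  have ne': "d \<noteq> b" "a \<noteq> c" "d \<noteq> x1" "a \<noteq> x3"
    using x(3,4) ab(2,4,5) cd(3,4,5) d2(5) d1(1) d3(1) by blast+
  \<comment> \<open>Both \<open>a\<close> and \<open>d\<close> see \<open>x2\<close>, so they are
    not adjacent. If they differ, domination makes \<open>d\<close> see \<open>b\<close> and
    \<open>a\<close> see \<open>c\<close>, and adjacent vertices have disjoint traces.\<close>
  have "P4 \<inter> P2 = {} \<and> P1 \<inter> P3 = {}"
  proof (cases "a = d")
    case True
    then have "P1 = P4" using ab(4) cd(5) by simp
    then show ?thesis using d1(4) d3(4) by (simp add: Int_commute)
  next
    case False
    then have "adj d b" "adj a c"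
      using triple_dom[OF ab(1), of d] triple_dom[OF cd(1), of a] nadj nda ne'
        tripleD[OF ab(1)] tripleD[OF cd(1)] by blast+
    then show ?thesis
      using nb_disjoint ab(4,5) cd(4,5) by blast
  qed
  \<comment> \<open>Any other \<open>v\<close> alternates along the path, so it lies in both
    \<open>P2\<close> and \<open>P4\<close> or in both \<open>P1\<close> and
    \<open>P3\<close>.\<close>
  then have "v = x1 \<or> v = x2 \<or> v = x3" if "v \<in> A" for v
    using that i by blast
  then have "A \<subseteq> {x1, x2, x3}" by blast
  then have "card A \<le> card {x1, x2, x3}"
    by (intro card_mono) auto
  also have "\<dots> \<le> 3"
    by (simp add: card_insert_if)
  finally show False using A_card by simp
qed

lemma ex_private_split:
  assumes "x \<in> A" "full x = {}" "2 \<le> card (star x)"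
  shows "\<exists>P Q. split x P Q \<and> (\<forall>x' Q'. split x' P Q' \<longrightarrow> x' = x)"
proof -
  obtain P Q where PQ: "split x P Q"
    using ex_split[OF assms] by blast
  show ?thesis
  proof (cases "\<forall>x' Q'. split x' P Q' \<longrightarrow> x' = x")
    case True
    with PQ show ?thesis by blast
  next
    case False
    then obtain x1 Q1 where x1: "split x1 P Q1" "x1 \<noteq> x" by blast
    have "\<forall>x' Q'. split x' Q Q' \<longrightarrow> x' = x"
      using split_no_path[OF split_sym[OF x1(1)] PQ _ x1(2)] by metis
    with split_sym[OF PQ] show ?thesis by blast
  qed
qed

text \<open>Each member is charged to its vertex with trace \<open>P\<close>. Two members sharing
  that vertex would have adjacent third vertices with the same nonempty trace
  \<open>Q\<close>.\<close>

lemma split_class: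
  assumes "split x P Q"
  shows "card (star x) \<le> card {v \<in> V - A. A \<inter> nb v = P}"
proof -
  let ?W = "{v \<in> V - A. A \<inter> nb v = P}"
  define g where "g S = (SOME v. v \<in> ?W \<and> v \<in> S)" for S
  have g: "g S \<in> ?W \<and> g S \<in> S" if Sx: "S \<in> star x" for S
  proof -
    obtain y z where y: "S = {x, y, z}" "{x, y, z} \<in> F" "y \<notin> A" "A \<inter> nb y = P"
      using split_memE[OF assms Sx] by metis
    then have "y \<in> ?W \<and> y \<in> S"
      using tripleD(2)[OF y(2)] by simp
    then show ?thesis
      unfolding g_def by (rule someI)
  qed
  have "inj_on g (star x)"
  proof (rule inj_onI, rule ccontr)
    fix S S' assume S: "S \<in> star x" "S' \<in> star x" and eq: "g S = g S'" and ne: "S \<noteq> S'"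
    define f where "f = g S"
    have f: "f \<in> V" "f \<notin> A" "A \<inter> nb f = P" "f \<in> S" "f \<in> S'"
      using g[OF S(1)] g[OF S(2)] eq by (auto simp: f_def)
    have fx: "f \<noteq> x" using f(2) splitD(1)[OF assms] by blast
    have third: "\<exists>t. S = {x, f, t} \<and> {x, f, t} \<in> F \<and> A \<inter> nb t = Q" if Sx: "S \<in> star x" "f \<in> S" for S
    proof -
      obtain y z where y: "S = {x, y, z}" "{x, y, z} \<in> F" "A \<inter> nb y = P" "A \<inter> nb z = Q"
        using split_memE[OF assms Sx(1)] by metis
      have "f \<noteq> z" using y(4) f(3) splitD[OF assms] by blast
      then have "f = y" using fx Sx(2) y(1) by blast
      with y show ?thesis by blast
    qed
    obtain t where t: "S = {x, f, t}" "{x, f, t} \<in> F" "A \<inter> nb t = Q"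
      using third[OF S(1) f(4)] by blast
    obtain t' where t': "S' = {x, f, t'}" "{x, f, t'} \<in> F" "A \<inter> nb t' = Q"
      using third[OF S(2) f(5)] by blast
    have "adj t t'"
      using third_adj[OF t(2) t'(2)] ne t(1) t'(1) by metis
    then show False
      using nb_disjoint t(3) t'(3) splitD(3)[OF assms] by blast
  qed
  then show ?thesis
    by (rule card_inj_on_le) (use g finite_V in auto)
qed

section \<open>Members with two vertices in \<open>A\<close>, and the total count\<close>

text \<open>The vertices charged for members meeting \<open>A\<close> twice; they have to be kept
  apart from those charged for stars.\<close>

definition centres where "centres = {v \<in> V - A. \<exists>a\<in>A. \<exists>b\<in>A. {a, b, v} \<in> F}"

lemma card_doubles_le: "card {S \<in> F. card (S \<inter> A) = 2} \<le> card centres"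
proof -
  let ?D = "{S \<in> F. card (S \<inter> A) = 2}"
  have "\<exists>v a b. S = {a, b, v} \<and> {a, b, v} \<in> F \<and> a \<in> A \<and> b \<in> A \<and> v \<in> V - A \<and> A - nb v = {a, b}"
    if SD: "S \<in> ?D" for S
  proof -
    obtain a b where ab: "S \<inter> A = {a, b}" "a \<noteq> b"
      using SD card_2_iff[of "S \<inter> A"] by auto
    then have abS: "a \<in> S" "b \<in> S" "a \<in> A" "b \<in> A" by blast+
    obtain v where v: "S = {a, b, v}"
      using F_mem2E[of S a b] SD abS(1,2) ab(2) by blast
    then have vF: "{a, b, v} \<in> F" using SD by simp
    note t = tripleD[OF vF]
    have "v \<notin> A" using ab(1) v t(5,6) by auto
    moreover have "A - nb v = {a, b}"
    proof
      show "{a, b} \<subseteq> A - nb v"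
        using t abS by (auto simp: nb_def)
      show "A - nb v \<subseteq> {a, b}"
      proof
        fix c assume c: "c \<in> A - nb v"
        then have "\<not> adj c v"
          using adj_comm by (auto simp: nb_def)
        then show "c \<in> {a, b}"
          using triple_dom[OF vF, of c] A_V A_indep abS(3,4) c \<open>v \<notin> A\<close> by blast
      qed
    qed
    ultimately show ?thesis
      using v vF abS t(3) by blast
  qed
  from bchoice[OF ballI[OF this]] obtain g where
    g: "\<forall>S\<in>?D. \<exists>a b. S = {a, b, g S} \<and> {a, b, g S} \<in> F \<and> a \<in> A \<and> b \<in> A \<and>
      g S \<in> V - A \<and> A - nb (g S) = {a, b}" ..
  have "inj_on g ?D"
  proof (rule inj_onI)
    fix S S' assume S: "S \<in> ?D" "S' \<in> ?D" "g S = g S'"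
    have "S = insert (g S) (A - nb (g S))" "S' = insert (g S') (A - nb (g S'))"
      using bspec[OF g S(1)] bspec[OF g S(2)] by auto
    with S(3) show "S = S'" by simp
  qed
  moreover have "g ` ?D \<subseteq> centres"
  proof
    fix v assume "v \<in> g ` ?D"
    then obtain S where S: "S \<in> ?D" "v = g S" by blast
    from bspec[OF g S(1)] show "v \<in> centres"
      unfolding S(2) centres_def by blast
  qed
  moreover have "finite centres"
    using finite_V by (simp add: centres_def)
  ultimately show ?thesis
    by (rule card_inj_on_le)
qed

text \<open>A centre misses two vertices of \<open>A\<close>, a full vertex at most one.\<close>

lemma full_not_centre:
  assumes "v \<in> full x"
  shows "v \<notin> centres"
proof
  assume "v \<in> centres"
  then obtain a b where ab: "a \<in> A" "b \<in> A" "{a, b, v} \<in> F"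
    by (auto simp: centres_def)
  note t = tripleD[OF ab(3)]
  have "a \<notin> nb v" "b \<notin> nb v"
    using t by (simp_all add: nb_def)
  moreover have "A \<inter> nb v = A - {x}"
    using assms by (simp add: full_def)
  ultimately show False
    using ab(1,2) t(4) by blast
qed

text \<open>Since the star has two members, a second vertex \<open>v'\<close> has trace
  \<open>P\<close>. It also misses \<open>a\<close> and \<open>b\<close>, so it must see
  \<open>v\<close>, although the two share a neighbour in \<open>P\<close>.\<close>

lemma split_not_centre:
  assumes sp: "split x P Q" and v: "A \<inter> nb v = P"
  shows "v \<notin> centres"
proof
  assume "v \<in> centres"
  then obtain a b where ab: "a \<in> A" "b \<in> A" "{a, b, v} \<in> F"
    by (auto simp: centres_def)
  note t = tripleD[OF ab(3)]
  let ?W = "{v \<in> V - A. A \<inter> nb v = P}"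
  have "2 \<le> card ?W"
    using split_class[OF sp] sp by (simp add: split_def)
  then have "\<not> ?W \<subseteq> {v}"
    using card_mono[of "{v}" ?W] by auto
  then obtain v' where v': "v' \<in> V" "v' \<notin> A" "A \<inter> nb v' = P" "v' \<noteq> v" by blast
  have "a \<notin> nb v'" "b \<notin> nb v'"
    using v v'(3) ab t by (auto simp: nb_def)
  then have "adj v' v"
    using triple_dom[OF ab(3) v'(1)] v'(2,4) ab(1,2) by (auto simp: nb_def)
  then show False
    using nb_disjoint v v'(3) splitD(2)[OF sp] by blast
qed

text \<open>Each vertex pays for at most one member: a centre for one meeting \<open>A\<close>
  twice, a vertex of \<open>W x\<close> for one in \<open>star x\<close>, and \<open>x\<close>
  itself for the extra one allowed by the \<open>Suc\<close> in \<open>good\<close>.\<close>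

lemma card_meeting_le: "card {S \<in> F. S \<inter> A \<noteq> {}} \<le> card V"
proof -
  define own where "own x W \<longleftrightarrow> (\<exists>P Q. split x P Q \<and> W = {v \<in> V - A. A \<inter> nb v = P} \<and>
      (\<forall>x' Q'. split x' P Q' \<longrightarrow> x' = x))" for x W
  \<comment> \<open>The set charged for \<open>star x\<close> will be \<open>full x\<close> if
    nonempty, otherwise the class of a private trace of a split, and empty if the star has at most
    one member.\<close>
  define good where "good x W \<longleftrightarrow> W \<subseteq> V - A \<and> W \<inter> centres = {} \<and> card (star x) \<le> Suc (card W) \<and>
    (W = {} \<or> W = full x \<or> own x W)" for x W
  have "\<exists>W. good x W" if x: "x \<in> A" for x
  proof (cases "full x = {}")
    case False
    have "good x (full x)"
      using card_star_le_full[OF x False] full_not_centre unfolding good_def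
      by (auto simp: full_def)
    then show ?thesis by blast
  next
    case fl: True
    show ?thesis
    proof (cases "2 \<le> card (star x)")
      case True
      obtain P Q where PQ: "split x P Q" "\<forall>x' Q'. split x' P Q' \<longrightarrow> x' = x"
        using ex_private_split[OF x fl True] by blast
      let ?W = "{v \<in> V - A. A \<inter> nb v = P}"
      have "?W \<inter> centres = {}"
        using split_not_centre[OF PQ(1)] by blast
      moreover have "card (star x) \<le> Suc (card ?W)"
        using split_class[OF PQ(1)] by simp
      moreover have "own x ?W"
        using PQ unfolding own_def by blast
      ultimately have "good x ?W"
        unfolding good_def by blast
      then show ?thesis by blast
    next
      case False
      then have "good x {}"
        by (simp add: good_def)
      then show ?thesis by blast
    qed
  qed
  from bchoice[OF ballI[OF this]] obtain W where W: "\<forall>x\<in>A. good x (W x)" ..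
  have Wsub: "W x \<subseteq> V - A" "W x \<inter> centres = {}" "card (star x) \<le> Suc (card (W x))" if "x \<in> A" for x
    using W that unfolding good_def by blast+
  have Wcases: "A \<inter> nb v = A - {x} \<or> (\<exists>P Q. split x P Q \<and> A \<inter> nb v = P \<and> (\<forall>x' Q'. split x' P Q' \<longrightarrow> x' = x))"
    if xv: "x \<in> A" "v \<in> W x" for x v
  proof -
    consider "W x = full x" | "own x (W x)"
      using bspec[OF W xv(1)] xv(2) unfolding good_def by blast
    then show ?thesis
    proof cases
      case 1
      then show ?thesis using xv(2) by (simp add: full_def)
    next
      case 2
      then obtain P Q where PQ: "split x P Q" "W x = {v \<in> V - A. A \<inter> nb v = P}"
          "\<forall>x' Q'. split x' P Q' \<longrightarrow> x' = x"
        unfolding own_def by metis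
      have "A \<inter> nb v = P" using xv(2) unfolding PQ(2) by simp
      with PQ(1,3) show ?thesis by blast
    qed
  qed
  \<comment> \<open>\<open>x\<close> lies in \<open>A\<close> but not in \<open>P\<close>, so it is
    the vertex missing from \<open>A - {x'}\<close>. Full vertices and split classes of different
    vertices therefore never clash.\<close>
  have split_full: "x = x'" if "split x P Q" "P = A - {x'}" for x x' P Q
    using split_iff[OF that(1), of x] that(2) splitD(1)[OF that(1)] by blast
  have disj: "W x \<inter> W x' = {}" if x: "x \<in> A" "x' \<in> A" "x \<noteq> x'" for x x'
  proof (rule ccontr)
    assume "W x \<inter> W x' \<noteq> {}"
    then obtain v where v: "v \<in> W x" "v \<in> W x'" by blast
    from Wcases[OF x(1) v(1)] Wcases[OF x(2) v(2)] show False
    proof (elim disjE exE conjE)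
      assume "A \<inter> nb v = A - {x}" "A \<inter> nb v = A - {x'}"
      with x show False by blast
    next
      fix P Q assume "A \<inter> nb v = A - {x}" "A \<inter> nb v = P" "split x' P Q"
      with split_full x(3) show False by metis
    next
      fix P Q assume "A \<inter> nb v = A - {x'}" "A \<inter> nb v = P" "split x P Q"
      with split_full x(3) show False by metis
    next
      fix P Q P' Q' assume "A \<inter> nb v = P" "split x P Q" "A \<inter> nb v = P'" "split x' P' Q'"
        "\<forall>x' Q'. split x' P Q' \<longrightarrow> x' = x"
      with x(3) show False by metis
    qed
  qed
  have finW: "finite (W x)" if "x \<in> A" for x
    using Wsub(1)[OF that] finite_V by (rule finite_subset[OF _ finite_Diff])
  have sub: "{S \<in> F. S \<inter> A \<noteq> {}} \<subseteq> {S \<in> F. card (S \<inter> A) = 2} \<union> (\<Union>x\<in>A. star x)"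
  proof
    fix S assume "S \<in> {S \<in> F. S \<inter> A \<noteq> {}}"
    then obtain x where S: "S \<in> F" "x \<in> S" "x \<in> A" by blast
    obtain y z where yz: "S = {x, y, z}"
      using F_memE[OF S(1,2)] .
    then have yF: "{x, y, z} \<in> F" using S(1) by simp
    note t = tripleD[OF yF]
    \<comment> \<open>A member inside \<open>A\<close> would leave a fourth vertex of
      \<open>A\<close> undominated.\<close>
    have "\<not> (y \<in> A \<and> z \<in> A)"
    proof
      assume yzA: "y \<in> A \<and> z \<in> A"
      have "\<not> A \<subseteq> {x, y, z}"
        using A_card card_mono[of "{x, y, z}" A] by (auto simp: card_insert_if split: if_splits)
      then obtain a where "a \<in> A" "a \<noteq> x" "a \<noteq> y" "a \<noteq> z" by blast
      then show False
        using triple_dom[OF yF, of a] A_indep A_V S(3) yzA by blast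
    qed
    then consider "y \<in> A" "z \<notin> A" | "y \<notin> A" "z \<in> A" | "y \<notin> A" "z \<notin> A" by blast
    then show "S \<in> {S \<in> F. card (S \<inter> A) = 2} \<union> (\<Union>x\<in>A. star x)"
    proof cases
      case 1
      then have "S \<inter> A = {x, y}" using yz S(3) by auto
      then show ?thesis using S(1) t(4) by simp
    next
      case 2
      then have "S \<inter> A = {x, z}" using yz S(3) by auto
      then show ?thesis using S(1) t(5) by simp
    next
      case 3
      then have "S \<inter> A = {x}" using yz S(3) by auto
      then show ?thesis using S(1,3) by (auto simp: star_def)
    qed
  qed
  have "card {S \<in> F. S \<inter> A \<noteq> {}} \<le> card ({S \<in> F. card (S \<inter> A) = 2} \<union> (\<Union>x\<in>A. star x))"
    using sub finite_F finite_A finite_star by (intro card_mono) auto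
  also have "\<dots> \<le> card {S \<in> F. card (S \<inter> A) = 2} + card (\<Union>x\<in>A. star x)"
    by (rule card_Un_le)
  also have "\<dots> \<le> card centres + (\<Sum>x\<in>A. card (star x))"
    using card_doubles_le card_UN_le[OF finite_A, of star] by linarith
  also have "(\<Sum>x\<in>A. card (star x)) \<le> (\<Sum>x\<in>A. Suc (card (W x)))"
    using Wsub(3) by (intro sum_mono) auto
  also have "\<dots> = card A + card (\<Union>x\<in>A. W x)"
    using card_UN_disjoint[of A W] finite_A finW disj by (simp add: sum_Suc)
  also have "card centres + (card A + card (\<Union>x\<in>A. W x)) = card (centres \<union> (A \<union> (\<Union>x\<in>A. W x)))"
  proof -
    have "A \<inter> (\<Union>x\<in>A. W x) = {}" "centres \<inter> (A \<union> (\<Union>x\<in>A. W x)) = {}"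
      using Wsub(1,2) unfolding centres_def by blast+
    moreover have "finite centres"
      using finite_V by (simp add: centres_def)
    moreover have "finite (\<Union>x\<in>A. W x)"
      using finite_A finW by blast
    ultimately show ?thesis
      using finite_A by (simp add: card_Un_disjoint)
  qed
  also have "\<dots> \<le> card V"
    using Wsub(1) A_V by (intro card_mono finite_V) (auto simp: centres_def)
  finally show ?thesis by simp
qed

end

section \<open>From a neighbourhood to the whole family\<close>

lemma card_F_le_degree:
  assumes "4 \<le> card (nb v)"
  shows "card F \<le> card V + card {S \<in> F. v \<in> S}"
proof -
  have "nb v \<noteq> {}" using assms by auto
  then have vV: "v \<in> V" using adj_V by (auto simp: nb_def)
  have sub: "nb v \<subseteq> V" using adj_V by (auto simp: nb_def)
  have "F \<subseteq> {S \<in> F. S \<inter> nb v \<noteq> {}} \<union> {S \<in> F. v \<in> S}"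
  proof
    fix S assume S: "S \<in> F"
    then obtain u where "v \<in> S \<or> u \<in> S \<and> adj v u"
      using sys vV unfolding system3'_def maximal_independent_set_def by blast
    then show "S \<in> {S \<in> F. S \<inter> nb v \<noteq> {}} \<union> {S \<in> F. v \<in> S}"
      using S by (auto simp: nb_def)
  qed
  then have "card F \<le> card ({S \<in> F. S \<inter> nb v \<noteq> {}} \<union> {S \<in> F. v \<in> S})"
    using finite_F by (intro card_mono) auto
  also have "\<dots> \<le> card {S \<in> F. S \<inter> nb v \<noteq> {}} + card {S \<in> F. v \<in> S}"
    by (rule card_Un_le)
  also have "card {S \<in> F. S \<inter> nb v \<noteq> {}} \<le> card V"
    by (rule card_meeting_le[OF sub _ assms]) (rule nb_indep)
  finally show ?thesis by simp
qed

subsection \<open>Vertices in many members\<close>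

text \<open>
  If \<open>y1 \<noteq> y2\<close>, then every other non-neighbour of \<open>z\<close> is adjacent to \<open>y\<close>. At most one member
  through \<open>z\<close> avoids \<open>y\<close>, \<open>y1\<close> and \<open>y2\<close>, and at most two contain each of these: seven in total.
\<close>

lemma heavy_third_unique:
  assumes heavy: "8 \<le> card {S \<in> F. z \<in> S}"
    and F: "{z, y, y1} \<in> F" "{z, y, y2} \<in> F"
  shows "y1 = y2"
proof (rule ccontr)
  assume ne: "y1 \<noteq> y2"
  note t1 = tripleD[OF F(1)] and t2 = tripleD[OF F(2)]
  have "adj y1 y2"
    using third_adj[OF F ne] .
  let ?G = "{S \<in> F. z \<in> S \<and> y \<notin> S \<and> y1 \<notin> S \<and> y2 \<notin> S}"
  have adjy: "adj s y" if s: "s \<in> S" "s \<noteq> z" "S \<in> ?G" for s S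
  proof -
    obtain t where t: "S = {z, s, t}"
      using F_mem2E[of S z s] s by blast
    then have "{z, s, t} \<in> F" using s(3) by simp
    note ts = tripleD[OF this]
    have "s \<noteq> y" "s \<noteq> y1" "s \<noteq> y2" using s by blast+
    then have "adj s y \<or> adj s y1 \<and> adj s y2"
      using triple_dom[OF F(1) ts(2)] triple_dom[OF F(2) ts(2)] ts(4,8) by blast
    with \<open>adj y1 y2\<close> no_triangle show ?thesis by blast
  qed
  \<comment> \<open>In two such members all vertices other than \<open>z\<close> see
    \<open>y\<close>, so they are pairwise nonadjacent, and domination forces the members to
    coincide.\<close>
  have "card ?G \<le> 1"
  proof (rule ccontr)
    assume "\<not> ?thesis"
    then have "2 \<le> card ?G" by simp
    then obtain T where "T \<subseteq> ?G" "card T = 2"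
      by (rule obtain_subset_with_card_n)
    then obtain S S' where S: "S \<in> ?G" "S' \<in> ?G" "S \<noteq> S'"
      unfolding card_2_iff by blast
    obtain s t where st: "S = {z, s, t}"
      using F_memE[of S z] S(1) by blast
    obtain p q where pq: "S' = {z, p, q}"
      using F_memE[of S' z] S(2) by blast
    have stF: "{z, s, t} \<in> F" and pqF: "{z, p, q} \<in> F"
      using S st pq by simp_all
    note tst = tripleD[OF stF] and tpq = tripleD[OF pqF]
    have "s \<in> S" "t \<in> S" "p \<in> S'" "q \<in> S'"
      using st pq by simp_all
    then have a: "adj s y" "adj t y" "adj p y" "adj q y"
      using adjy[OF _ tst(4)[symmetric] S(1)] adjy[OF _ tst(5)[symmetric] S(1)]
        adjy[OF _ tpq(4)[symmetric] S(2)] adjy[OF _ tpq(5)[symmetric] S(2)] by blast+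
    then have na: "\<not> adj p s" "\<not> adj p t" "\<not> adj q s" "\<not> adj q t"
      using no_triangle adj_comm by blast+
    then have "p = s \<or> p = t" "q = s \<or> q = t"
      using triple_dom[OF stF, of p] triple_dom[OF stF, of q] tpq by blast+
    then have "S = S'" using st pq tpq(6) by auto
    with S(3) show False ..
  qed
  have sub: "{S \<in> F. z \<in> S} \<subseteq> {S \<in> F. z \<in> S \<and> y \<in> S} \<union> ({S \<in> F. z \<in> S \<and> y1 \<in> S} \<union>
      ({S \<in> F. z \<in> S \<and> y2 \<in> S} \<union> ?G))"
    by blast
  have "card {S \<in> F. z \<in> S} \<le> card {S \<in> F. z \<in> S \<and> y \<in> S} + (card {S \<in> F. z \<in> S \<and> y1 \<in> S} +
      (card {S \<in> F. z \<in> S \<and> y2 \<in> S} + card ?G))"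
    by (rule order.trans[OF card_mono[OF _ sub]])
      (use finite_F in \<open>auto intro!: order.trans[OF card_Un_le] add_mono\<close>)
  also have "\<dots> \<le> 2 + (2 + (2 + 1))"
    using card_codegree_le_2 t1 t2 \<open>card ?G \<le> 1\<close> by (intro add_mono) auto
  finally show False using heavy by simp
qed

lemma heavy_shared:
  assumes "8 \<le> card {S \<in> F. z \<in> S}"
    and "S \<in> F" "S' \<in> F" "z \<in> S" "z \<in> S'" "S \<noteq> S'" "y \<in> S" "y \<in> S'"
  shows "y = z"
proof (rule ccontr)
  assume ne: "y \<noteq> z"
  obtain y1 where y1: "S = {z, y, y1}"
    using F_mem2E[OF assms(2,4,7) ne[symmetric]] .
  obtain y2 where y2: "S' = {z, y, y2}"
    using F_mem2E[OF assms(3,5,8) ne[symmetric]] .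
  have "y1 = y2"
    using heavy_third_unique[OF assms(1)] assms(2,3) unfolding y1 y2 .
  with y1 y2 assms(6) show False by simp
qed

section \<open>The crown formed by the members through a vertex lying in eight of them\<close>

text \<open>In a third member \<open>{z, p, q}\<close>, \<open>u\<close> sees \<open>p\<close> or
  \<open>q\<close>, which in turn sees \<open>s\<close> or \<open>t\<close>: a triangle with
  \<open>u\<close>.\<close>

lemma crown_not_both:
  assumes heavy: "8 \<le> card {S \<in> F. z \<in> S}"
    and F: "{z, u, w} \<in> F" "{z, s, t} \<in> F" "{z, u, w} \<noteq> {z, s, t}"
  shows "\<not> (adj u s \<and> adj u t)"
proof
  assume us: "adj u s \<and> adj u t"
  have "\<not> {S \<in> F. z \<in> S} \<subseteq> {{z, u, w}, {z, s, t}}"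
  proof
    assume "{S \<in> F. z \<in> S} \<subseteq> {{z, u, w}, {z, s, t}}"
    then have "card {S \<in> F. z \<in> S} \<le> card {{z, u, w}, {z, s, t}}"
      by (intro card_mono) simp_all
    also have "\<dots> \<le> 2"
      using card_length[of "[{z, u, w}, {z, s, t}]"] by simp
    finally show False using heavy by simp
  qed
  then obtain S where S: "S \<in> F" "z \<in> S" "S \<noteq> {z, u, w}" "S \<noteq> {z, s, t}" by blast
  obtain p q where pq: "S = {z, p, q}"
    using F_memE[OF S(1,2)] .
  have S': "{z, p, q} \<in> F"
    using S(1) pq by simp
  note tp = tripleD[OF S'] and ts = tripleD[OF F(2)] and tu = tripleD[OF F(1)]
  have ne: "u \<noteq> p" "u \<noteq> q"
    using heavy_shared[OF heavy S(1) F(1) S(2) _ S(3), of u] tu(4) pq by auto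
  have ne': "p \<noteq> s" "p \<noteq> t" "q \<noteq> s" "q \<noteq> t"
    using heavy_shared[OF heavy S(1) F(2) S(2) _ S(4), of s]
      heavy_shared[OF heavy S(1) F(2) S(2) _ S(4), of t] ts(4,5) pq by auto
  have "adj u p \<or> adj u q"
    using triple_dom[OF S', of u] ne tu by blast
  moreover have "adj p s \<or> adj p t" "adj q s \<or> adj q t"
    using triple_dom[OF F(2), of p] triple_dom[OF F(2), of q] ne' tp by blast+
  ultimately show False
    using us no_triangle by blast
qed

text \<open>Domination gives each of the four vertices a neighbour in the other pair, and
  \<open>crown_not_both\<close> allows \<open>u\<close> and \<open>w\<close> only one each, so the
  edges form a perfect matching.\<close>

lemma crown_pair:
  assumes heavy: "8 \<le> card {S \<in> F. z \<in> S}"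
    and F: "{z, u, w} \<in> F" "{z, s, t} \<in> F" "{z, u, w} \<noteq> {z, s, t}"
  shows "adj u t \<and> adj w s \<and> \<not> adj u s \<and> \<not> adj w t \<or> adj u s \<and> adj w t \<and> \<not> adj u t \<and> \<not> adj w s"
proof -
  have F': "{z, w, u} \<in> F"
    using F(1) by (simp add: insert_commute)
  note ts = tripleD[OF F(2)] and tu = tripleD[OF F(1)]
  have ne: "u \<noteq> s" "u \<noteq> t" "w \<noteq> s" "w \<noteq> t"
    using heavy_shared[OF heavy F(1,2) _ _ F(3), of s] heavy_shared[OF heavy F(1,2) _ _ F(3), of t]
      ts(4,5) by auto
  have "adj u s \<or> adj u t" "adj w s \<or> adj w t"
    using triple_dom[OF F(2), of u] triple_dom[OF F(2), of w] ne tu by blast+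
  moreover have "adj s u \<or> adj s w" "adj t u \<or> adj t w"
    using triple_dom[OF F(1), of s] triple_dom[OF F(1), of t] ne ts by blast+
  moreover have "\<not> (adj u s \<and> adj u t)" "\<not> (adj w s \<and> adj w t)"
    using crown_not_both[OF heavy F] crown_not_both[OF heavy F' F(2)] F(3)
    by (simp_all add: insert_commute)
  ultimately show ?thesis
    using adj_comm by blast
qed

text \<open>Stated so that the two sides of the crown can be exchanged. Since \<open>w1\<close> sees
  both \<open>u i\<close> and \<open>s\<close>, \<open>u i\<close> is dominated through
  \<open>t\<close>. A neighbour \<open>a\<close> of \<open>z\<close> that saw \<open>w i\<close>
  would be undominated by \<open>{u1, s, t}\<close>: it shares \<open>w i\<close> as a neighbour
  with \<open>u1\<close> and \<open>s\<close>, and \<open>z\<close> with \<open>t\<close>.\<close>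

lemma crown_neighbours:
  fixes u w :: "'i \<Rightarrow> 'a"
  assumes F1: "{z, u1, w1} \<in> F" and FI: "\<And>i. i \<in> I \<Longrightarrow> {z, u i, w i} \<in> F"
    and uw1: "\<And>i. i \<in> I \<Longrightarrow> adj u1 (w i)" "\<And>i. i \<in> I \<Longrightarrow> adj w1 (u i)" "\<And>i. i \<in> I \<Longrightarrow> \<not> adj u1 (u i)"
    and uw: "\<And>i j. i \<in> I \<Longrightarrow> j \<in> I \<Longrightarrow> i \<noteq> j \<Longrightarrow> adj (u i) (w j) \<and> u i \<noteq> u j"
    and st: "{u1, s, t} \<in> F" "adj z t" "\<not> adj z s" "adj w1 s"
    and card: "3 \<le> card I" and i: "i \<in> I" "u i \<noteq> s"
  shows "adj (u i) t" "adj z a \<Longrightarrow> \<not> adj (w i) a"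
proof -
  note t1 = tripleD[OF F1] and ts = tripleD[OF st(1)]
  have adj_t: "adj (u j) t" if j: "j \<in> I" "u j \<noteq> s" for j
  proof -
    note tj = tripleD[OF FI[OF j(1)]]
    have "\<not> adj (u j) s"
      using no_triangle[OF uw1(2)[OF j(1)] st(4)] .
    moreover have "u j \<noteq> u1"
      using uw1(2)[OF j(1)] t1(12) by metis
    moreover have "u j \<noteq> t"
      using st(2) tj(7) by metis
    moreover have "\<not> adj (u j) u1"
      using uw1(3)[OF j(1)] adj_comm by blast
    ultimately show ?thesis
      using triple_dom[OF st(1) tj(2)] j(2) by blast
  qed
  then show "adj (u i) t" using i .
  show "\<not> adj (w i) a" if a: "adj z a"
  proof
    assume wa: "adj (w i) a"
    note ti = tripleD[OF FI[OF i(1)]]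
    \<comment> \<open>At most one index has \<open>u j = s\<close>, so three indices leave one that
      also differs from \<open>i\<close>.\<close>
    have "\<exists>j. j \<in> I \<and> j \<noteq> i \<and> u j \<noteq> s"
    proof (rule ccontr)
      assume neg: "\<not> ?thesis"
      obtain j k l where "j \<in> I" "k \<in> I" "l \<in> I" "j \<noteq> k" "j \<noteq> l" "k \<noteq> l"
        using card by (rule card_ge_3E)
      with neg uw show False by metis
    qed
    then obtain j where j: "j \<in> I" "j \<noteq> i" "u j \<noteq> s" by blast
    have "\<not> adj (w i) t"
      using no_triangle[of "u j" "w i" t] uw[OF j(1) i(1) j(2)] adj_t[OF j(1,3)] by blast
    then have "a \<noteq> t" using wa by blast
    moreover have "a \<noteq> u1" "a \<noteq> s"
      using a t1(7) st(3) by blast+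
    moreover have "\<not> adj a t"
      using no_triangle[OF a st(2)] .
    moreover have "\<not> adj a u1"
      using no_triangle[OF wa adj_sym[OF uw1(1)[OF i(1)]]] .
    moreover have "\<not> adj a s"
    proof -
      have "\<not> adj s (u i)"
        using no_triangle[OF st(4) uw1(2)[OF i(1)]] .
      moreover have "s \<noteq> z" "s \<noteq> w i"
        using st(4) t1(10) uw1(1)[OF i(1)] ts(7) by blast+
      moreover have "\<not> adj s z"
        using st(3) adj_comm by blast
      ultimately have "adj s (w i)"
        using triple_dom[OF FI[OF i(1)] ts(2)] i(2) by blast
      then show ?thesis
        using no_triangle[OF wa adj_sym] by blast
    qed
    ultimately show False
      using triple_dom[OF st(1), of a] adj_V[OF a] by blast
  qed
qed

text \<open>A counterexample \<open>z\<close> has a crown in which \<open>u1\<close> and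
  \<open>w1\<close> get seven neighbours each, so both lie in eight members as well. The crown at
  \<open>u1\<close> then makes some \<open>u S\<close> see a neighbour of \<open>z\<close>, and the
  crown at \<open>w1\<close> forbids this.\<close>

lemma degree_lt_4_if_all_heavy:
  assumes heavy: "\<And>v. 4 \<le> card (nb v) \<Longrightarrow> 8 \<le> card {S \<in> F. v \<in> S}"
  shows "card (nb z) < 4"
proof (rule ccontr)
  assume "\<not> ?thesis"
  then have hz: "8 \<le> card {S \<in> F. z \<in> S}"
    using heavy by simp
  then have "{S \<in> F. z \<in> S} \<noteq> {}" by fastforce
  then obtain S1 where S1: "S1 \<in> F" "z \<in> S1" by blast
  obtain u1 w1 where uw: "S1 = {z, u1, w1}"
    using F_memE[OF S1] .
  have F1: "{z, u1, w1} \<in> F" using S1(1) uw by simp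
  note t1 = tripleD[OF F1]
  define I where "I = {S \<in> F. z \<in> S} - {S1}"
  have cI: "7 \<le> card I"
    using hz S1 finite_F by (simp add: I_def card_Diff_singleton)
  have "\<exists>p. S = {z, fst p, snd p} \<and> adj u1 (snd p) \<and> adj w1 (fst p) \<and> \<not> adj u1 (fst p) \<and> \<not> adj w1 (snd p)"
    if S: "S \<in> I" for S
  proof -
    have S': "S \<in> F" "z \<in> S" "S \<noteq> S1" using S by (auto simp: I_def)
    obtain s t where st: "S = {z, s, t}"
      using F_memE[OF S'(1,2)] .
    then have "{z, s, t} \<in> F" using S'(1) by simp
    note cp = crown_pair[OF hz F1 this]
    have "{z, u1, w1} \<noteq> {z, s, t}" using S'(3) uw st by simp
    from cp[OF this] show ?thesis
    proof
      assume "adj u1 t \<and> adj w1 s \<and> \<not> adj u1 s \<and> \<not> adj w1 t"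
      then show ?thesis using st by (intro exI[of _ "(s, t)"]) simp
    next
      assume "adj u1 s \<and> adj w1 t \<and> \<not> adj u1 t \<and> \<not> adj w1 s"
      then show ?thesis using st by (intro exI[of _ "(t, s)"]) (simp add: insert_commute)
    qed
  qed
  from bchoice[OF ballI[OF this]] obtain p where p: "\<forall>S\<in>I. S = {z, fst (p S), snd (p S)} \<and>
      adj u1 (snd (p S)) \<and> adj w1 (fst (p S)) \<and> \<not> adj u1 (fst (p S)) \<and> \<not> adj w1 (snd (p S))" ..
  define u where "u S = fst (p S)" for S
  define w where "w S = snd (p S)" for S
  have eq: "S = {z, u S, w S}" if "S \<in> I" for S
    using p that unfolding u_def w_def by blast
  have FI: "{z, u S, w S} \<in> F" if "S \<in> I" for S
    using eq[OF that] that by (simp add: I_def)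
  have a1: "adj u1 (w S)" "adj w1 (u S)" "\<not> adj u1 (u S)" "\<not> adj w1 (w S)" if "S \<in> I" for S
    using p that unfolding u_def w_def by blast+
  have a2: "adj (u S) (w T)" if ST: "S \<in> I" "T \<in> I" "S \<noteq> T" for S T
  proof -
    have "{z, u S, w S} \<noteq> {z, u T, w T}"
      using eq ST by metis
    moreover have "\<not> adj (u S) (u T)"
      using no_triangle[OF a1(2)[OF ST(1)] a1(2)[OF ST(2)]] .
    ultimately show ?thesis
      using crown_pair[OF hz FI[OF ST(1)] FI[OF ST(2)]] by blast
  qed
  have inju: "u S \<noteq> u T" if ST: "S \<in> I" "T \<in> I" "S \<noteq> T" for S T
    using a2[OF ST] tripleD(11)[OF FI[OF ST(2)]] by metis
  have injw: "w S \<noteq> w T" if ST: "S \<in> I" "T \<in> I" "S \<noteq> T" for S T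
    using a2[OF ST] tripleD(11)[OF FI[OF ST(1)]] by metis
  have large: "8 \<le> card {S \<in> F. v \<in> S}" if f: "\<And>S. S \<in> I \<Longrightarrow> adj v (f S)" "inj_on f I" for v f
  proof -
    have "7 \<le> card (f ` I)" using cI f(2) by (simp add: card_image)
    also have "\<dots> \<le> card (nb v)"
      using f(1) by (intro card_mono finite_nb) (auto simp: nb_def)
    finally show ?thesis using heavy by simp
  qed
  have hu: "8 \<le> card {S \<in> F. u1 \<in> S}"
    using large[of u1 w] a1(1) injw by (meson inj_onI)
  have hw: "8 \<le> card {S \<in> F. w1 \<in> S}"
    using large[of w1 u] a1(2) inju by (meson inj_onI)
  \<comment> \<open>Any second member through \<open>x\<close> is compared with
    \<open>{x, z, y}\<close> by \<open>crown_pair\<close>: \<open>t\<close> is the vertex matched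
    with \<open>z\<close>, and \<open>s\<close> the one matched with \<open>y\<close>.\<close>
  have key: "\<exists>s t. {x, s, t} \<in> F \<and> adj z t \<and> \<not> adj z s \<and> adj y s"
    if hx: "8 \<le> card {S \<in> F. x \<in> S}" and zxy: "{x, z, y} \<in> F" for x y
  proof -
    have "\<not> {S \<in> F. x \<in> S} \<subseteq> {{x, z, y}}"
      using hx card_mono[of "{{x, z, y}}" "{S \<in> F. x \<in> S}"] by auto
    then obtain S where S: "S \<in> F" "x \<in> S" "S \<noteq> {x, z, y}" by blast
    obtain s t where st: "S = {x, s, t}"
      using F_memE[OF S(1,2)] .
    then have stF: "{x, s, t} \<in> F" "{x, t, s} \<in> F"
      using S(1) by (simp_all add: insert_commute)
    show ?thesis
      using crown_pair[OF hx zxy stF(1)] S(3) st stF by metis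
  qed
  have "{u1, z, w1} \<in> F" "{w1, z, u1} \<in> F" and F1': "{z, w1, u1} \<in> F"
    using F1 by (simp_all add: insert_commute)
  then obtain s t s' t' where st: "{u1, s, t} \<in> F" "adj z t" "\<not> adj z s" "adj w1 s"
    and st': "{w1, s', t'} \<in> F" "adj z t'" "\<not> adj z s'" "adj u1 s'"
    using key[OF hu] key[OF hw] by metis
  \<comment> \<open>Each of the two conditions excludes at most one \<open>S\<close>, so three
    candidates suffice.\<close>
  have "\<exists>S\<in>I. u S \<noteq> s \<and> w S \<noteq> s'"
  proof (rule ccontr)
    assume neg: "\<not> ?thesis"
    have "3 \<le> card I" using cI by simp
    then obtain j k l where "j \<in> I" "k \<in> I" "l \<in> I" "j \<noteq> k" "j \<noteq> l" "k \<noteq> l"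
      by (rule card_ge_3E)
    with neg inju injw show False by metis
  qed
  then obtain S where S: "S \<in> I" "u S \<noteq> s" "w S \<noteq> s'" by blast
  have c3: "3 \<le> card I" using cI by simp
  have "adj (u S) t"
    by (rule crown_neighbours(1)[where I = I and u = u and w = w, OF F1 FI a1(1-3) _ st c3 S(1,2)])
      (use a2 inju in auto)
  moreover have "\<not> adj (u S) t"
  \<comment> \<open>The sides of the crown are exchanged here, with the member through
    \<open>w1\<close> in place of the one through \<open>u1\<close>.\<close>
  proof (rule crown_neighbours(2)[where I = I and u = w and w = u, OF F1' _ a1(2) a1(1) a1(4) _ st' c3 S(1,3) st(2)])
    show "{z, w i, u i} \<in> F" if "i \<in> I" for i
      using FI[OF that] by (simp add: insert_commute)
    show "adj (w i) (u j) \<and> w i \<noteq> w j" if "i \<in> I" "j \<in> I" "i \<noteq> j" for i j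
      using adj_sym[OF a2[OF that(2,1)]] injw that by metis
  qed
  ultimately show False by blast
qed

text \<open>In the case of small degrees a member dominates at most twelve vertices, itself
  included, and \<open>4096 = 2 ^ 12\<close> bounds any family of subsets.\<close>

lemma card_F_le: "card F \<le> card V + 4096"
proof (cases "\<exists>v. 4 \<le> card (nb v) \<and> card {S \<in> F. v \<in> S} < 8")
  case True
  then obtain v where "4 \<le> card (nb v)" "card {S \<in> F. v \<in> S} < 8" by blast
  with card_F_le_degree[of v] show ?thesis by simp
next
  case False
  then have small: "card (nb v) \<le> 3" for v
    using degree_lt_4_if_all_heavy[of v] by fastforce
  show ?thesis
  proof (cases "F = {}")
    case False
    then obtain S where S: "S \<in> F" by blast
    then have "card S = 3" using sys by (simp add: system3'_def)
    then obtain x y z where "S = {x, y, z}" unfolding card_3_iff by blast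
    with S have xF: "{x, y, z} \<in> F" by simp
    have "V \<subseteq> {x, y, z} \<union> (nb x \<union> (nb y \<union> nb z))"
      using triple_dom[OF xF] adj_comm unfolding nb_def by blast
    then have "card V \<le> card ({x, y, z} \<union> (nb x \<union> (nb y \<union> nb z)))"
      using finite_nb by (intro card_mono) auto
    also have "\<dots> \<le> card {x, y, z} + (card (nb x) + (card (nb y) + card (nb z)))"
      by (intro order.trans[OF card_Un_le] add_mono order.refl)
    also have "\<dots> \<le> 3 + (3 + (3 + 3))"
      using small by (intro add_mono) (auto simp: card_insert_if)
    finally have "card V \<le> 12" by simp
    then have "card F \<le> 2 ^ 12"
      using system3'_family(4)[OF sys] power_increasing[of "card V" 12 "2::nat"] by simp
    then show ?thesis by simp
  qed simp
qed

end

subsection \<open>The asymptotics\<close>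

lemma s3'_le: "s3' 3 m \<le> m + 4096"
proof -
  obtain H :: "nat pair_pre_digraph" and F where H: "system3' 3 H F" "card (pverts H) = m" "card F = s3' 3 m"
    by (rule s3'_attained)
  interpret mis3 H F
    using H(1) by unfold_locales
  show ?thesis
    using card_F_le H by simp
qed

section \<open>The lower bound construction\<close>

text \<open>The sides of the bipartite graph are the parity classes, and the removed path runs
  through the vertices in increasing order.\<close>

definition path_bicomplement :: "nat \<Rightarrow> nat pair_pre_digraph" where
  "path_bicomplement m = \<lparr>pverts = {..<m},
     parcs = {(i, j). i < m \<and> j < m \<and> odd (i + j) \<and> i \<noteq> Suc j \<and> j \<noteq> Suc i}\<rparr>"

text \<open>Outside the triple, a vertex of the parity of \<open>i\<close> sees
  \<open>Suc i\<close>. One of the other parity sees \<open>i\<close> unless it immediately precedes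
  \<open>i\<close>, and then it sees \<open>Suc (Suc i)\<close>, at distance three.\<close>

lemma system3'_path_bicomplement: "system3' 3 (path_bicomplement m) ((\<lambda>i. {i, Suc i, Suc (Suc i)}) ` {..<m - 2})"
  unfolding system3'_def
proof (intro conjI ballI)
  show "pair_graph (path_bicomplement m)"
  proof unfold_locales
    show "finite (parcs (path_bicomplement m))"
      by (rule finite_subset[of _ "{..<m} \<times> {..<m}"]) (auto simp: path_bicomplement_def)
  qed (auto simp: path_bicomplement_def symmetric_def sym_def add.commute)
  show "triangle_free (path_bicomplement m)"
    unfolding triangle_free_def path_bicomplement_def by (auto; presburger)
  fix S assume "S \<in> (\<lambda>i. {i, Suc i, Suc (Suc i)}) ` {..<m - 2}"
  then obtain i where i: "i < m - 2" "S = {i, Suc i, Suc (Suc i)}" by blast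
  then show sub: "S \<subseteq> pverts (path_bicomplement m)"
    by (auto simp: path_bicomplement_def)
  show "card S = 3"
    using i(2) by simp
  have "\<exists>u\<in>S. (v, u) \<in> parcs (path_bicomplement m)" if v: "v < m" "v \<notin> S" for v
  proof (cases "even (v + i)")
    case False
    then have "(v, i) \<in> parcs (path_bicomplement m) \<or> Suc v = i"
      using v i by (auto simp: path_bicomplement_def)
    moreover have "(v, Suc (Suc i)) \<in> parcs (path_bicomplement m)" if "Suc v = i"
      using v i that by (auto simp: path_bicomplement_def)
    ultimately show ?thesis using i(2) by blast
  next
    case True
    then have "(v, Suc i) \<in> parcs (path_bicomplement m)"
      using v i by (auto simp: path_bicomplement_def)
    then show ?thesis using i(2) by blast
  qed
  then show "maximal_independent_set (path_bicomplement m) S"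
    using sub i unfolding maximal_independent_set_def independent_set_def
    by (auto simp: path_bicomplement_def)
qed

lemma s3'_ge: "m - 2 \<le> s3' 3 m"
proof -
  have "inj_on (\<lambda>i. {i, Suc i, Suc (Suc i)}) {..<m - 2}"
    by (rule inj_on_inverseI[of _ Min]) simp
  then have "m - 2 = card ((\<lambda>i. {i, Suc i, Suc (Suc i)}) ` {..<m - 2})"
    by (simp add: card_image)
  also have "\<dots> \<le> s3' 3 (card (pverts (path_bicomplement m)))"
    by (rule s3'_upper[OF system3'_path_bicomplement])
  finally show ?thesis
    by (simp add: path_bicomplement_def)
qed

theorem theorem37:
  shows "(\<lambda>m. real (s3' 3 m) - real m) \<in> O(\<lambda>_. 1)"
proof (rule bigoI[of _ 4096], rule always_eventually, rule allI)
  fix m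
  have "real (s3' 3 m) \<le> real m + 4096" "real m - 2 \<le> real (s3' 3 m)"
    using s3'_le[of m] s3'_ge[of m] by linarith+
  then show "norm (real (s3' 3 m) - real m) \<le> 4096 * norm (1 :: real)"
    by simp
qed

end
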